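(* In the formal power series ring $\mathbb{Q}[[x]]$, let $\beta=\frac{1-\sqrt{1-4x}}{2}=\sum_{k=0}^{\infty}\frac{1}{k+1}\binom{2k}{k}x^{k+1}$, so that $\beta(1-\beta)=x$. Then \[ \sum_{k=1}^{\infty}\binom{2k}{k}\left(\frac{H_k^{(2)}}{k}+\frac{1}{k^3}\right)x^k=4\,{\rm Li}_3(\beta)+\frac{2}{3}{\rm Li}_1(\beta)^3. \]
   Context: $H_k^{(2)}=\sum_{j=1}^{k}1/j^2$. For an integer $d$, ${\rm Li}_d(t)=\sum_{k=1}^{\infty}t^k/k^d$ is the polylogarithm viewed as a formal power series; ${\rm Li}_d(\beta)$ denotes its composition with $\beta\in x\mathbb{Q}[[x]]$. *)

theory Defs
  imports "HOL-Computational_Algebra.Formal_Power_Series"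
begin

unbundle fps_syntax

definition harm2 :: "nat \<Rightarrow> rat" where
  "harm2 k = (\<Sum>j=1..k. 1 / of_nat j ^ 2)"

definition polylog_fps :: "int \<Rightarrow> rat fps" where
  "polylog_fps d = Abs_fps (\<lambda>k. if k = 0 then 0 else 1 / of_nat k powi d)"

(* The first argument of fps_radical chooses the root of the constant term; only
   its value for the square root of 1 is used, so this is the square root of
   1 - 4x with constant term 1. *)
definition beta_fps :: "rat fps" where
  "beta_fps = (1 - fps_radical (\<lambda>_ _. 1) 2 (1 - 4 * fps_X)) / 2"

end

theory Submission
  imports Defs
begin

text \<open>
  With \<open>s = 1 - 2\<beta> = sqrt (1 - 4x)\<close> and \<open>L = Li\<^sub>1(\<beta>)\<close>, differentiating \<open>\<beta>(1 - \<beta>) = x\<close> gives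
  \<open>\<beta>' = 1/s\<close>, so the Euler operator \<open>x d/dx\<close> sends \<open>L\<close> to \<open>\<beta>/s\<close> and \<open>Li\<^bsub>d+1\<^esub>(\<beta>)\<close> to
  \<open>(1 - \<beta>) Li\<^sub>d(\<beta>)/s\<close>. Since \<open>1/s\<close> generates the central binomial coefficients, comparing Euler
  derivatives successively sums the series with terms \<open>binom(2k,k)/k\<close>, \<open>binom(2k,k)/k\<^sup>2\<close> and
  \<open>binom(2k,k) H\<^sub>k\<close> (the harmonic numbers of order 2), to \<open>2L\<close>, \<open>2 Li\<^sub>2(\<beta>) - L\<^sup>2\<close> and \<open>(2 Li\<^sub>2(\<beta>) + L\<^sup>2)/s\<close>. The sum of the last
  two is the Euler derivative of both sides of the theorem.
\<close>

section \<open>The series beta, its derivative and its coefficients\<close>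

lemma one_minus_two_beta_fps: "1 - 2 * beta_fps = fps_radical (\<lambda>_ _. 1) 2 (1 - 4 * fps_X)"
proof -
  \<comment> \<open>Since 2 is a unit of the series ring, it divides every series, so the division
    in \<open>beta_fps\<close> is exact and can be undone.\<close>
  have "(2 :: rat fps) dvd 1"
    by (simp add: fps_is_unit_iff)
  then have "(2 :: rat fps) dvd a" for a
    using dvd_trans one_dvd by blast
  then show ?thesis
    by (simp add: beta_fps_def)
qed

lemma one_minus_two_beta_fps_square: "(1 - 2 * beta_fps)\<^sup>2 = 1 - 4 * fps_X"
proof -
  have "fps_radical (\<lambda>_ _. 1) (Suc 1) (1 - 4 * fps_X :: rat fps) ^ Suc 1 = 1 - 4 * fps_X"
    by (subst power_radical[symmetric]) auto
  then show ?thesis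
    by (simp add: one_minus_two_beta_fps numeral_2_eq_2)
qed

lemma beta_fps_nth_0 [simp]: "beta_fps $ 0 = 0"
proof -
  have "(1 - 2 * beta_fps) $ 0 = 1"
    unfolding one_minus_two_beta_fps by (simp add: numeral_2_eq_2)
  then show ?thesis by simp
qed

lemma beta_fps_quadratic: "beta_fps * (1 - beta_fps) = fps_X"
proof -
  have "4 * (beta_fps * (1 - beta_fps)) = 4 * fps_X"
    using one_minus_two_beta_fps_square by (simp add: power2_eq_square algebra_simps)
  then show ?thesis by simp
qed

lemma one_minus_two_beta_fps_nonzero: "1 - 2 * beta_fps \<noteq> 0"
proof
  assume "1 - 2 * beta_fps = 0"
  then have "(1 - 2 * beta_fps) $ 0 = 0" by simp
  then show False by simp
qed

lemma fps_deriv_beta_fps: "(1 - 2 * beta_fps) * fps_deriv beta_fps = 1"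
  using arg_cong[OF beta_fps_quadratic, of fps_deriv] by (simp add: algebra_simps)

text \<open>Absorption is applied twice, with the symmetry of row 2n + 1 in between.\<close>

lemma central_binomial_Suc:
  "Suc n * ((2 * Suc n) choose Suc n) = (4 * n + 2) * ((2 * n) choose n)"
proof -
  have "Suc n * ((2 * Suc n) choose Suc n) = 2 * (Suc n * (Suc (2 * n) choose n))"
    using Suc_times_binomial_eq[of "Suc (2 * n)" n]
    by (simp add: algebra_simps del: binomial_Suc_Suc)
  also have "Suc (2 * n) choose n = Suc (2 * n) choose Suc n"
    by (subst binomial_symmetric) auto
  also have "Suc n * (Suc (2 * n) choose Suc n) = Suc (2 * n) * ((2 * n) choose n)"
    using Suc_times_binomial_eq[of "2 * n" n] by (simp only: mult.commute)
  finally show ?thesis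
    by (simp del: binomial_Suc_Suc)
qed

text \<open>Multiplying s beta' = 1 by s gives the linear equation (1 - 4x) beta' = s, whose
  coefficients satisfy the recurrence of \<open>central_binomial_Suc\<close>.\<close>

lemma beta_fps_nth_Suc: "beta_fps $ Suc n = of_nat ((2 * n) choose n) / of_nat (Suc n)"
proof (induction n)
  case 0
  have "((1 - 2 * beta_fps) * fps_deriv beta_fps) $ 0 = 1"
    by (simp only: fps_deriv_beta_fps fps_one_nth if_True simp_thms)
  then show ?case by simp
next
  case (Suc n)
  define B where "B = fps_deriv beta_fps"
  have "(1 - 4 * fps_X) * B = (1 - 2 * beta_fps) * ((1 - 2 * beta_fps) * B)"
    unfolding one_minus_two_beta_fps_square[symmetric] by (simp add: power2_eq_square)
  then have "(1 - 4 * fps_X) * B = 1 - 2 * beta_fps"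
    by (simp add: B_def fps_deriv_beta_fps)
  then have "((1 - 4 * fps_X) * B) $ Suc n = (1 - 2 * beta_fps) $ Suc n"
    by simp
  then have "B $ Suc n - 4 * B $ n = - 2 * beta_fps $ Suc n"
    by (simp add: left_diff_distrib mult.assoc numeral_fps_const)
  then have rec: "of_nat (n + 2) * beta_fps $ (Suc (Suc n)) = of_nat (4 * n + 2) * beta_fps $ Suc n"
    by (simp add: B_def algebra_simps)
  have "of_nat (Suc n) * of_nat ((2 * Suc n) choose Suc n)
      = (of_nat (4 * n + 2) * of_nat ((2 * n) choose n) :: rat)"
    using central_binomial_Suc[of n] by (simp only: flip: of_nat_mult)
  then have "of_nat ((2 * Suc n) choose Suc n) = of_nat (4 * n + 2) * beta_fps $ Suc n"
    by (simp add: Suc field_simps del: of_nat_Suc binomial_Suc_Suc)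
  with rec show ?case
    by (simp add: field_simps del: binomial_Suc_Suc)
qed

text \<open>The Euler operator kills only constants. The factor s clears the denominators 1/s of all
  derivatives below, so no series has to be inverted.\<close>

lemma fps_eqI_euler:
  fixes f g :: "rat fps"
  assumes "(1 - 2 * beta_fps) * (fps_X * fps_deriv f) = (1 - 2 * beta_fps) * (fps_X * fps_deriv g)"
    and "f $ 0 = g $ 0"
  shows "f = g"
proof -
  have "fps_deriv f = fps_deriv g"
    using assms(1) one_minus_two_beta_fps_nonzero by simp
  then show ?thesis
    using assms(2) by (simp add: fps_deriv_eq_iff)
qed

section \<open>Euler derivatives of polylogarithms of beta\<close>

lemma polylog_fps_nth_0 [simp]: "polylog_fps d $ 0 = 0"
  by (simp add: polylog_fps_def)

lemma fps_X_deriv_polylog_fps: "fps_X * fps_deriv (polylog_fps (d + 1)) = polylog_fps d"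
  by (rule fps_ext) (auto simp: polylog_fps_def power_int_add gr0_conv_Suc simp del: of_nat_Suc)

lemma fps_deriv_polylog_fps_1: "(1 - fps_X) * fps_deriv (polylog_fps 1) = 1"
proof -
  have "fps_deriv (polylog_fps 1) = Abs_fps (\<lambda>_. 1)"
    by (rule fps_ext) (simp add: polylog_fps_def del: of_nat_Suc)
  then show ?thesis
    by (intro fps_ext) (simp add: left_diff_distrib)
qed

text \<open>In the chain rule, x is split as beta (1 - beta): the factor beta turns the inner
  derivative into Li_d(beta), and s beta' = 1 removes the outer one.\<close>

lemma euler_polylog_beta:
  "(1 - 2 * beta_fps) * (fps_X * fps_deriv (polylog_fps (d + 1) oo beta_fps))
     = (1 - beta_fps) * (polylog_fps d oo beta_fps)"
proof -
  let ?Q = "fps_deriv (polylog_fps (d + 1)) oo beta_fps"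
  have "beta_fps * ?Q = polylog_fps d oo beta_fps"
    by (simp add: fps_compose_mult_distrib fps_X_deriv_polylog_fps[of d, symmetric])
  moreover have "(1 - 2 * beta_fps) * (fps_X * fps_deriv (polylog_fps (d + 1) oo beta_fps))
      = (1 - beta_fps) * (beta_fps * ?Q) * ((1 - 2 * beta_fps) * fps_deriv beta_fps)"
    by (simp add: fps_compose_deriv flip: beta_fps_quadratic)
  ultimately show ?thesis
    by (simp add: fps_deriv_beta_fps)
qed

text \<open>Here Li_1'(t) = 1/(1 - t), so the factor 1 - beta of x cancels and beta remains.\<close>

lemma euler_polylog_1_beta:
  "(1 - 2 * beta_fps) * (fps_X * fps_deriv (polylog_fps 1 oo beta_fps)) = beta_fps"
proof -
  let ?Q = "fps_deriv (polylog_fps 1) oo beta_fps"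
  have "(1 - beta_fps) * ?Q = ((1 - fps_X) * fps_deriv (polylog_fps 1)) oo beta_fps"
    by (simp add: fps_compose_mult_distrib fps_compose_sub_distrib)
  then have "(1 - beta_fps) * ?Q = 1"
    by (simp add: fps_deriv_polylog_fps_1)
  moreover have "(1 - 2 * beta_fps) * (fps_X * fps_deriv (polylog_fps 1 oo beta_fps))
      = beta_fps * ((1 - beta_fps) * ?Q) * ((1 - 2 * beta_fps) * fps_deriv beta_fps)"
    by (simp add: fps_compose_deriv flip: beta_fps_quadratic)
  ultimately show ?thesis
    by (simp add: fps_deriv_beta_fps)
qed

lemma fps_X_deriv_nth [simp]: "(fps_X * fps_deriv f) $ n = of_nat n * f $ n"
  by (cases n) simp_all

section \<open>Central binomial sums in closed form\<close>

lemma central_binomial_gf_div: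
  "Abs_fps (\<lambda>k. of_nat ((2 * k) choose k) / of_nat k) = 2 * (polylog_fps 1 oo beta_fps)"
  (is "?E = 2 * ?L")
proof (rule fps_eqI_euler)
  \<comment> \<open>The series beta' generates the central binomial coefficients; its constant term
    1 is removed because division by zero makes the term of \<open>?E\<close> at k = 0
    vanish.\<close>
  have "fps_X * fps_deriv ?E = fps_deriv beta_fps - 1"
    by (rule fps_ext) (auto simp: beta_fps_nth_Suc simp del: of_nat_Suc)
  then have "(1 - 2 * beta_fps) * (fps_X * fps_deriv ?E) = 2 * beta_fps"
    by (simp add: right_diff_distrib fps_deriv_beta_fps)
  also have "\<dots> = 2 * ((1 - 2 * beta_fps) * (fps_X * fps_deriv ?L))"
    by (simp only: euler_polylog_1_beta)
  also have "\<dots> = (1 - 2 * beta_fps) * (fps_X * fps_deriv (2 * ?L))"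
    by (simp add: algebra_simps)
  finally show "(1 - 2 * beta_fps) * (fps_X * fps_deriv ?E)
      = (1 - 2 * beta_fps) * (fps_X * fps_deriv (2 * ?L))" .
qed simp

lemma euler_polylog_1_beta_square:
  "(1 - 2 * beta_fps) * (fps_X * fps_deriv ((polylog_fps 1 oo beta_fps)\<^sup>2))
     = 2 * (polylog_fps 1 oo beta_fps) * beta_fps"
proof -
  let ?L = "polylog_fps 1 oo beta_fps"
  have "(1 - 2 * beta_fps) * (fps_X * fps_deriv (?L\<^sup>2))
      = 2 * ?L * ((1 - 2 * beta_fps) * (fps_X * fps_deriv ?L))"
    by (simp add: power2_eq_square algebra_simps)
  then show ?thesis
    by (simp only: euler_polylog_1_beta)
qed

lemma euler_polylog_2_beta:
  "(1 - 2 * beta_fps) * (fps_X * fps_deriv (polylog_fps 2 oo beta_fps))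
     = (1 - beta_fps) * (polylog_fps 1 oo beta_fps)"
  using euler_polylog_beta[of 1] by simp

lemma central_binomial_gf_div_square:
  "Abs_fps (\<lambda>k. of_nat ((2 * k) choose k) / of_nat k ^ 2)
     = 2 * (polylog_fps 2 oo beta_fps) - (polylog_fps 1 oo beta_fps)\<^sup>2"
  (is "?B = 2 * ?P - ?L\<^sup>2")
proof (rule fps_eqI_euler)
  have "fps_X * fps_deriv ?B = Abs_fps (\<lambda>k. of_nat ((2 * k) choose k) / of_nat k)"
    by (rule fps_ext) (auto simp: power2_eq_square)
  then have "(1 - 2 * beta_fps) * (fps_X * fps_deriv ?B) = (1 - 2 * beta_fps) * (2 * ?L)"
    by (simp only: central_binomial_gf_div)
  \<comment> \<open>Splits s as (1 - beta) - beta; the two pieces come from Li_2(beta) and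
    L^2.\<close>
  also have "\<dots> = 2 * ((1 - 2 * beta_fps) * (fps_X * fps_deriv ?P))
      - (1 - 2 * beta_fps) * (fps_X * fps_deriv (?L\<^sup>2))"
    unfolding euler_polylog_2_beta euler_polylog_1_beta_square by (simp add: algebra_simps)
  also have "\<dots> = (1 - 2 * beta_fps) * (fps_X * fps_deriv (2 * ?P - ?L\<^sup>2))"
    by (simp add: algebra_simps)
  finally show "(1 - 2 * beta_fps) * (fps_X * fps_deriv ?B)
      = (1 - 2 * beta_fps) * (fps_X * fps_deriv (2 * ?P - ?L\<^sup>2))" .
qed (simp add: power2_eq_square)

text \<open>The increment 1/(n+1)^2 of \<open>harm2\<close> leaves an inhomogeneous term that is a
  coefficient of the series 2L.\<close>

lemma central_binomial_harm2_rec: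
  "of_nat (Suc n) * (of_nat ((2 * Suc n) choose Suc n) * harm2 (Suc n))
     = of_nat (4 * n + 2) * (of_nat ((2 * n) choose n) * harm2 n)
       + of_nat ((2 * Suc n) choose Suc n) / of_nat (Suc n)"
proof -
  let ?C = "of_nat ((2 * Suc n) choose Suc n) :: rat"
  have "of_nat (Suc n) * (?C * harm2 (Suc n))
      = (of_nat (Suc n) * ?C) * harm2 n + ?C / of_nat (Suc n)"
    by (simp add: harm2_def power2_eq_square distrib_left del: of_nat_Suc binomial_Suc_Suc mult_Suc_right)
  also have "of_nat (Suc n) * ?C = of_nat (4 * n + 2) * of_nat ((2 * n) choose n)"
    using central_binomial_Suc[of n] by (simp only: flip: of_nat_mult)
  finally show ?thesis by (simp only: mult.assoc)
qed

lemma central_binomial_harm2_gf: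
  "(1 - 2 * beta_fps) * Abs_fps (\<lambda>k. of_nat ((2 * k) choose k) * harm2 k)
     = 2 * (polylog_fps 2 oo beta_fps) + (polylog_fps 1 oo beta_fps)\<^sup>2"
  (is "?s * ?A = 2 * ?P + ?L\<^sup>2")
proof (rule fps_eqI_euler)
  have "(fps_X * fps_deriv ?A - 4 * (fps_X * (fps_X * fps_deriv ?A)) - 2 * (fps_X * ?A)) $ n
      = of_nat ((2 * n) choose n) / of_nat n" for n
  proof (cases n)
    case (Suc m)
    have "(fps_X * fps_deriv ?A - 4 * (fps_X * (fps_X * fps_deriv ?A)) - 2 * (fps_X * ?A)) $ Suc m
        = of_nat (Suc m) * ?A $ Suc m - of_nat (4 * m + 2) * ?A $ m"
      by (simp add: numeral_fps_const algebra_simps del: fps_nth_Abs_fps)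
    with Suc show ?thesis
      using central_binomial_harm2_rec[of m] by (simp only: fps_nth_Abs_fps)
  qed simp
  then have "fps_X * fps_deriv ?A - 4 * (fps_X * (fps_X * fps_deriv ?A)) - 2 * (fps_X * ?A)
      = Abs_fps (\<lambda>k. of_nat ((2 * k) choose k) / of_nat k)"
    by (intro fps_ext) simp
  then have rec: "(1 - 4 * fps_X) * (fps_X * fps_deriv ?A) - 2 * fps_X * ?A = 2 * ?L"
    by (simp only: central_binomial_gf_div left_diff_distrib mult_1_left mult.assoc)
  \<comment> \<open>Here s acts as an integrating factor: by the product rule and s beta' = 1, the
    left-hand side of \<open>rec\<close> is s times the Euler derivative of
    \<open>?s * ?A\<close>.\<close>
  have "?s * (fps_X * fps_deriv (?s * ?A))
      = ?s\<^sup>2 * (fps_X * fps_deriv ?A) - 2 * fps_X * ?A * (?s * fps_deriv beta_fps)"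
    by (simp add: algebra_simps power2_eq_square)
  also have "\<dots> = 2 * ?L"
    by (simp add: one_minus_two_beta_fps_square fps_deriv_beta_fps rec)
  \<comment> \<open>Now 1 is split as (1 - beta) + beta, whence the plus sign before L^2.\<close>
  also have "\<dots> = 2 * (?s * (fps_X * fps_deriv ?P)) + ?s * (fps_X * fps_deriv (?L\<^sup>2))"
    unfolding euler_polylog_2_beta euler_polylog_1_beta_square by (simp add: algebra_simps)
  also have "\<dots> = ?s * (fps_X * fps_deriv (2 * ?P + ?L\<^sup>2))"
    by (simp add: algebra_simps)
  finally show "?s * (fps_X * fps_deriv (?s * ?A)) = ?s * (fps_X * fps_deriv (2 * ?P + ?L\<^sup>2))" .
qed (simp add: power2_eq_square harm2_def)

lemma central_binomial_harm2_polylog: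
  "Abs_fps (\<lambda>k. if k = 0 then 0 else
      of_nat ((2 * k) choose k) * (harm2 k / of_nat k + 1 / of_nat k ^ 3))
   = 4 * (polylog_fps 3 oo beta_fps) + fps_const (2 / 3) * (polylog_fps 1 oo beta_fps) ^ 3"
  (is "?F = 4 * ?T + fps_const (2 / 3) * ?L ^ 3")
proof (rule fps_eqI_euler)
  let ?s = "1 - 2 * beta_fps" and ?P = "polylog_fps 2 oo beta_fps"
  let ?A = "Abs_fps (\<lambda>k. of_nat ((2 * k) choose k) * harm2 k)"
  let ?B = "Abs_fps (\<lambda>k. of_nat ((2 * k) choose k) / of_nat k ^ 2) :: rat fps"
  have "fps_X * fps_deriv ?F = ?A + ?B"
    by (rule fps_ext) (auto simp: harm2_def power2_eq_square power3_eq_cube field_simps)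
  then have "?s * (fps_X * fps_deriv ?F) = 2 * ?P + ?L\<^sup>2 + ?s * (2 * ?P - ?L\<^sup>2)"
    by (simp only: distrib_left central_binomial_harm2_gf central_binomial_gf_div_square)
  \<comment> \<open>Uses 1 + s = 2(1 - beta) and 1 - s = 2 beta.\<close>
  also have "\<dots> = 4 * ((1 - beta_fps) * ?P) + 2 * ?L\<^sup>2 * beta_fps"
    by (simp add: algebra_simps)
  \<comment> \<open>The last beta is s times the Euler derivative of L, so integrating 2 L^2
    produces the coefficient 2/3 of L^3.\<close>
  also have "\<dots> = 4 * (?s * (fps_X * fps_deriv ?T)) + 2 * ?L\<^sup>2 * (?s * (fps_X * fps_deriv ?L))"
    using euler_polylog_beta[of 2] by (simp add: euler_polylog_1_beta)
  also have "\<dots> = ?s * (fps_X * fps_deriv (4 * ?T + fps_const (2 / 3) * ?L ^ 3))"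
  proof -
    have "fps_deriv (fps_const (2 / 3) * ?L ^ 3) = fps_const (2 / 3) * 3 * ?L\<^sup>2 * fps_deriv ?L"
      by (simp add: power2_eq_square power3_eq_cube algebra_simps)
    also have "fps_const (2 / 3) * 3 = (2 :: rat fps)"
      by (simp add: numeral_fps_const)
    finally show ?thesis
      by (simp add: algebra_simps)
  qed
  finally show "?s * (fps_X * fps_deriv ?F)
      = ?s * (fps_X * fps_deriv (4 * ?T + fps_const (2 / 3) * ?L ^ 3))" .
qed (simp add: power3_eq_cube)

theorem theorem5p2:
  shows "beta_fps = Abs_fps (\<lambda>n. if n = 0 then 0 else
             1 / of_nat ((n - 1) + 1) * of_nat ((2 * (n - 1)) choose (n - 1)))
       \<and> beta_fps * (1 - beta_fps) = fps_X
       \<and> Abs_fps (\<lambda>k. if k = 0 then 0 else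
             of_nat ((2 * k) choose k) * (harm2 k / of_nat k + 1 / of_nat k ^ 3))
         = 4 * (polylog_fps 3 oo beta_fps)
           + fps_const (2 / 3) * (polylog_fps 1 oo beta_fps) ^ 3"
proof (intro conjI)
  show "beta_fps = Abs_fps (\<lambda>n. if n = 0 then 0 else
      1 / of_nat ((n - 1) + 1) * of_nat ((2 * (n - 1)) choose (n - 1)))"
    by (rule fps_ext) (auto simp: gr0_conv_Suc beta_fps_nth_Suc)
qed (rule beta_fps_quadratic, rule central_binomial_harm2_polylog)

end
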